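(* Let $L$ be a divisorial lattice domain. Then $L$ is h-local.
   Context: A multiplicative lattice is a complete lattice $(L,\le)$ with bottom element $0$ and top element $1$, which is also a commutative monoid with identity $1$, such that $a(\bigvee_\alpha b_\alpha)=\bigvee_\alpha(ab_\alpha)$ for all $a,b_\alpha\in L$. An element $c\in L$ is compact if $S\subseteq L$ and $c\le\bigvee S$ imply $c\le\bigvee T$ for some finite $T\subseteq S$. For $x,y\in L$, $(y:x)=\bigvee\{a\in L \mid ax\le y\}$. An element $x\in L$ is principal if it satisfies both $y\wedge zx=((y:x)\wedge z)x$ and $y\vee(z:x)=((yx\vee z):x)$ for all $y,z\in L$. $L$ is principally generated if every element is a join of principal elements; $L$ is a $C$-lattice if $1$ is compact, the set of compact elements is closed under multiplication, and every element is a join of compact elements. Throughout, "lattice" means a multiplicative lattice which is a principally generated $C$-lattice. An element $p\in L\setminus\{1\}$ is prime if $xy\le p$ (with $x,y\in L$) implies $x\le p$ or $y\le p$. A maximal element is a maximal element of $L\setminus\{1\}$. A lattice domain is a lattice in which $0$ is a prime element. Divisorial closure: for a lattice domain $L$ and $a\in L\setminus\{0\}$, $a_v:=(x:(x:a))$ for some nonzero principal element $x\le a$ (the result does not depend on the choice of $x$). The element $a$ is divisorial if $a=a_v$; also $0$ is declared divisorial. A lattice domain $L$ is divisorial if all its elements are divisorial. A lattice domain $L$ is h-local if (i) every nonzero prime element of $L$ is below a unique maximal element, and (ii) for every $b\in L\setminus\{0\}$, the set of maximal elements above $b$ (i.e. $\ge b$) is finite. *)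

theory Defs
  imports Main
begin

text \<open>The zero element of a multiplicative lattice is \<open>bot\<close>; \<open>mult_Sup\<close> with \<open>B = {}\<close>
  gives \<open>a * bot = bot\<close>.\<close>

class multiplicative_lattice = complete_lattice + comm_monoid_mult +
  assumes one_eq_top: "1 = top"
    and mult_Sup: "a * Sup B = Sup ((*) a ` B)"
begin

definition compact_element :: "'a \<Rightarrow> bool" where
  "compact_element c \<longleftrightarrow> (\<forall>S. c \<le> Sup S \<longrightarrow> (\<exists>T. T \<subseteq> S \<and> finite T \<and> c \<le> Sup T))"

text \<open>\<open>residual y x\<close> is \<open>(y : x)\<close>.\<close>

definition residual :: "'a \<Rightarrow> 'a \<Rightarrow> 'a" where
  "residual y x = Sup {a. a * x \<le> y}"

definition principal :: "'a \<Rightarrow> bool" where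
  "principal x \<longleftrightarrow> (\<forall>y z.
     inf y (z * x) = inf (residual y x) z * x \<and>
     sup y (residual z x) = residual (sup (y * x) z) x)"

definition prime_element :: "'a \<Rightarrow> bool" where
  "prime_element p \<longleftrightarrow> p \<noteq> 1 \<and> (\<forall>x y. x * y \<le> p \<longrightarrow> x \<le> p \<or> y \<le> p)"

definition maximal_element :: "'a \<Rightarrow> bool" where
  "maximal_element m \<longleftrightarrow> m \<noteq> 1 \<and> (\<forall>y. y \<noteq> 1 \<longrightarrow> m \<le> y \<longrightarrow> y = m)"

end

class principally_generated_C_lattice = multiplicative_lattice +
  assumes principally_generated: "\<exists>S. (\<forall>s\<in>S. principal s) \<and> x = Sup S"
    and compact_one: "compact_element 1"
    and compact_mult: "compact_element c \<Longrightarrow> compact_element d \<Longrightarrow> compact_element (c * d)"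
    and compactly_generated: "\<exists>S. (\<forall>s\<in>S. compact_element s) \<and> x = Sup S"

class lattice_domain = principally_generated_C_lattice +
  assumes prime_bot: "prime_element bot"
begin

text \<open>For \<open>a \<noteq> bot\<close> such an \<open>x\<close> exists and its choice is irrelevant, see
  \<open>ex_principal_below\<close> and \<open>divisorial_closure_eq\<close> below.  At \<open>bot\<close> the value is unspecified.\<close>

definition divisorial_closure :: "'a \<Rightarrow> 'a" where
  "divisorial_closure a =
     (let x = (SOME x. principal x \<and> x \<noteq> bot \<and> x \<le> a) in residual x (residual x a))"

definition divisorial :: "'a \<Rightarrow> bool" where
  "divisorial a \<longleftrightarrow> a = bot \<or> a = divisorial_closure a"

end

definition divisorial_lattice_domain :: "'a::lattice_domain itself \<Rightarrow> bool" where
  "divisorial_lattice_domain _ \<longleftrightarrow> (\<forall>a::'a. divisorial a)"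

definition h_local :: "'a::lattice_domain itself \<Rightarrow> bool" where
  "h_local _ \<longleftrightarrow>
     (\<forall>p::'a. prime_element p \<and> p \<noteq> bot \<longrightarrow> (\<exists>!m. maximal_element m \<and> p \<le> m)) \<and>
     (\<forall>b::'a. b \<noteq> bot \<longrightarrow> finite {m. maximal_element m \<and> b \<le> m})"

context multiplicative_lattice
begin

lemma mult_mono_left:
  assumes "b \<le> c"
  shows "a * b \<le> a * c"
proof -
  have "a * c = a * Sup {b, c}" using assms by (simp add: sup_absorb2)
  also have "\<dots> = sup (a * b) (a * c)" by (subst mult_Sup) simp
  finally show ?thesis by (simp add: le_iff_sup)
qed

lemma le_residual_iff: "a \<le> residual y x \<longleftrightarrow> a * x \<le> y"
proof
  assume "a \<le> residual y x"
  then have "x * a \<le> x * Sup {a. a * x \<le> y}"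
    unfolding residual_def by (rule mult_mono_left)
  also have "\<dots> \<le> y"
    by (subst mult_Sup) (auto intro!: Sup_least simp: mult.commute)
  finally show "a * x \<le> y" by (simp add: mult.commute)
qed (auto simp: residual_def intro: Sup_upper)

end

context lattice_domain
begin

lemma ex_principal_below:
  assumes "a \<noteq> bot"
  shows "\<exists>x. principal x \<and> x \<noteq> bot \<and> x \<le> a"
proof -
  obtain S where S: "\<forall>s\<in>S. principal s" "a = Sup S"
    using principally_generated by blast
  with assms obtain s where "s \<in> S" "s \<noteq> bot"
    by (metis Sup_bot_conv(1))
  with S show ?thesis by (auto intro: Sup_upper)
qed

lemma principal_cancel:
  assumes "principal x" "x \<noteq> bot"
  shows "z * x \<le> w * x \<longleftrightarrow> z \<le> w"
proof
  assume *: "z * x \<le> w * x"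
  have "residual bot x * x \<le> bot" using le_residual_iff by blast
  then have "residual bot x = bot"
    using prime_bot assms(2) by (auto simp: prime_element_def bot_unique)
  moreover have "sup w (residual bot x) = residual (sup (w * x) bot) x"
    using assms(1) by (simp add: principal_def)
  ultimately have "w = residual (w * x) x" by simp
  with * show "z \<le> w" by (metis le_residual_iff)
qed (metis mult.commute mult_mono_left)

lemma double_residual_mult:
  assumes x: "principal x" "x \<noteq> bot" "x \<le> a" and y: "principal y" "y \<noteq> bot"
  shows "residual (x * y) (residual (x * y) a) = residual x (residual x a)"
proof -
  have "residual (x * y) a = residual x a * y"
  proof (rule order.antisym)
    define c where "c = residual (x * y) a"
    have ca: "c * a \<le> x * y" unfolding c_def using le_residual_iff by blast
    have "c * x \<le> c * a" using x(3) by (rule mult_mono_left)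
    with ca have "c * x \<le> y * x" by (simp add: mult.commute order_trans)
    then have "c \<le> y" using principal_cancel x by blast
    then have "c = inf (residual c y) 1 * y"
      using y(1) unfolding principal_def by (metis inf.absorb1 mult_1)
    then have d: "c = residual c y * y" by (simp add: one_eq_top)
    then have "(residual c y * a) * y \<le> x * y" using ca by (metis mult.assoc mult.commute)
    then have "residual c y \<le> residual x a"
      using principal_cancel y le_residual_iff by blast
    then have "residual c y * y \<le> residual x a * y" by (metis mult.commute mult_mono_left)
    with d show "residual (x * y) a \<le> residual x a * y" by (simp add: c_def)
    have "residual x a * a \<le> x" using le_residual_iff by blast
    then have "(residual x a * a) * y \<le> x * y" by (metis mult.commute mult_mono_left)
    then show "residual x a * y \<le> residual (x * y) a"
      by (simp add: le_residual_iff mult.assoc mult.commute mult.left_commute)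
  qed
  moreover have "e * (f * y) \<le> x * y \<longleftrightarrow> e * f \<le> x" for e f
    using principal_cancel[OF y] by (metis mult.assoc)
  ultimately show ?thesis by (simp add: residual_def)
qed

lemma divisorial_closure_eq:
  assumes "principal x" "x \<noteq> bot" "x \<le> a"
  shows "divisorial_closure a = residual x (residual x a)"
proof -
  define y where "y = (SOME x. principal x \<and> x \<noteq> bot \<and> x \<le> a)"
  have y: "principal y" "y \<noteq> bot" "y \<le> a"
    unfolding y_def using someI_ex[of "\<lambda>x. principal x \<and> x \<noteq> bot \<and> x \<le> a"] assms by blast+
  have "residual y (residual y a) = residual x (residual x a)"
    using double_residual_mult[OF assms y(1,2)] double_residual_mult[OF y assms(1,2)]
    by (simp add: mult.commute)
  then show ?thesis by (simp add: divisorial_closure_def y_def Let_def)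
qed

end

end

theory Submission
  imports Defs
begin

text \<open>If \<open>L\<close> is divisorial and \<open>x\<close> is a nonzero principal element, then \<open>a \<mapsto> (x : a)\<close> is an
  order-reversing involution of the interval \<open>[x, 1]\<close>, so it exchanges joins and meets there.
  Finiteness properties of joins, which compactness provides, thereby become finiteness properties
  of meets.  The consequence that carries the whole proof is \<open>Inf_not_le_maximal\<close>: a maximal
  element \<open>n \<ge> x\<close> behaves like a prime element for arbitrary, possibly infinite, meets of elements
  above \<open>x\<close>; if the meet of a family lies below \<open>n\<close>, then so does a member.

  For the finiteness condition, let \<open>A\<close> be the set of maximal elements above a nonzero \<open>b\<close>.
  Complete primeness shows that, for each \<open>n \<in> A\<close>, the meet of \<open>A - {n}\<close> is not below \<open>n\<close>.
  The join of these meets over all \<open>n \<in> A\<close> is therefore below no maximal element, so it is \<open>1\<close>.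
  As \<open>1\<close> is compact, finitely many \<open>n\<close> suffice; a maximal element of \<open>A\<close> other than these
  would be above all the meets involved, so there is none.

  For the uniqueness condition, let \<open>p\<close> be a nonzero prime below a maximal element \<open>n\<close>.  Complete
  primeness shows that among the elements above \<open>p\<close> and not below \<open>n\<close> there is a least one, \<open>c\<close>.
  A principal \<open>y \<le> c\<close> with \<open>y \<not>\<le> n\<close> satisfies \<open>y \<le> c \<le> y\<^sup>2 \<or> p\<close>, because \<open>y\<^sup>2 \<not>\<le> n\<close>.  Since \<open>p\<close>
  is prime, \<open>y\<close> can be cancelled modulo \<open>p\<close>, and \<open>y \<or> p = 1\<close> follows.  Hence \<open>c = 1\<close>, which
  means that every proper element above \<open>p\<close> is below \<open>n\<close>.\<close>

section \<open>Maximal elements\<close>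

context multiplicative_lattice
begin

lemma mult_mono:
  assumes "a \<le> b" "c \<le> d"
  shows "a * c \<le> b * d"
  by (metis assms mult_mono_left mult.commute order_trans)

lemma mult_le_left: "a * b \<le> a"
  by (metis mult_mono_left mult_1_right one_eq_top top_greatest)

lemma mult_le_right: "a * b \<le> b"
  using mult_le_left[of b a] by (simp add: mult.commute)

lemma mult_sup: "a * sup b c = sup (a * b) (a * c)"
  using mult_Sup[of a "{b, c}"] by simp

lemma maximal_sup_eq_one:
  assumes "maximal_element n" "\<not> a \<le> n"
  shows "sup n a = 1"
  using assms unfolding maximal_element_def by (metis sup_ge1 sup_ge2)

lemma maximal_element_prime:
  assumes n: "maximal_element n"
  shows "prime_element n"
  unfolding prime_element_def
proof (intro conjI allI impI)
  show "n \<noteq> 1" using n by (simp add: maximal_element_def)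
  fix a b assume ab: "a * b \<le> n"
  show "a \<le> n \<or> b \<le> n"
  proof (rule ccontr)
    assume "\<not> (a \<le> n \<or> b \<le> n)"
    then have "a = a * sup n b"
      using maximal_sup_eq_one[OF n] by simp
    then have "a \<le> n"
      using ab mult_le_right[of a n] by (metis mult_sup le_sup_iff)
    with \<open>\<not> (a \<le> n \<or> b \<le> n)\<close> show False by simp
  qed
qed

end

text \<open>Compactness of \<open>1\<close> makes the join of a chain of proper elements proper, so that Zorn's lemma
  applies.\<close>

lemma ex_maximal_above:
  fixes a :: "'a::principally_generated_C_lattice"
  assumes "a \<noteq> 1"
  shows "\<exists>m. maximal_element m \<and> a \<le> m"
proof -
  define P where "P = {b. a \<le> b \<and> b \<noteq> 1}"
  have "\<exists>m\<in>P. \<forall>b\<in>P. m \<le> b \<longrightarrow> b = m"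
  proof (rule predicate_Zorn)
    show "partial_order_on P (relation_of (\<le>) P)"
      by (rule partial_order_on_relation_ofI) auto
    fix C assume "C \<in> Chains (relation_of (\<le>) P)"
    then have sub: "C \<subseteq> P" and chain: "\<And>b c. b \<in> C \<Longrightarrow> c \<in> C \<Longrightarrow> b \<le> c \<or> c \<le> b"
      by (auto simp: Chains_def relation_of_def)
    show "\<exists>u\<in>P. \<forall>b\<in>C. b \<le> u"
    proof (cases "C = {}")
      case True
      then show ?thesis using assms by (auto simp: P_def)
    next
      case False
      have bounded: "\<exists>c\<in>C. Sup T \<le> c" if "finite T" "T \<subseteq> C" for T
        using that
      proof (induction T)
        case empty
        then show ?case using False by auto
      next
        case (insert t T)
        then obtain c where "c \<in> C" "Sup T \<le> c" "t \<in> C" by auto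
        with chain[of t c] show ?case by (auto intro: order_trans)
      qed
      have "Sup C \<noteq> 1"
      proof
        assume "Sup C = 1"
        then obtain T where "T \<subseteq> C" "finite T" "1 \<le> Sup T"
          using compact_one unfolding compact_element_def by (metis order_refl)
        with bounded obtain c where "c \<in> C" "1 \<le> c" by (meson order_trans)
        with sub show False by (auto simp: P_def one_eq_top top_unique)
      qed
      moreover have "a \<le> Sup C"
        using False sub by (auto simp: P_def intro: Sup_upper2)
      ultimately show ?thesis by (auto simp: P_def intro: Sup_upper)
    qed
  qed
  then obtain m where m: "a \<le> m" "m \<noteq> 1" "\<And>b. a \<le> b \<Longrightarrow> b \<noteq> 1 \<Longrightarrow> m \<le> b \<Longrightarrow> b = m"
    by (auto simp: P_def)
  then show ?thesis unfolding maximal_element_def by (metis order_trans)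
qed

section \<open>Residual duality\<close>

lemma residual_Sup: "residual x (Sup D) = (INF d\<in>D. residual x d)"
  for x :: "'a::multiplicative_lattice"
proof (rule order.antisym)
  show "residual x (Sup D) \<le> (INF d\<in>D. residual x d)"
  proof (rule INF_greatest)
    fix d assume "d \<in> D"
    have "residual x (Sup D) * Sup D \<le> x" by (simp flip: le_residual_iff)
    then show "residual x (Sup D) \<le> residual x d"
      unfolding le_residual_iff using mult_mono_left[OF Sup_upper[OF \<open>d \<in> D\<close>]]
      by (meson order_trans)
  qed
  have "(INF d\<in>D. residual x d) * d \<le> x" if "d \<in> D" for d
    using that by (simp add: INF_lower flip: le_residual_iff)
  then show "(INF d\<in>D. residual x d) \<le> residual x (Sup D)"
    by (auto simp: le_residual_iff mult_Sup intro: SUP_least)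
qed

lemma residual_antimono:
  fixes x :: "'a::multiplicative_lattice"
  assumes "a \<le> b"
  shows "residual x b \<le> residual x a"
  unfolding le_residual_iff
  by (rule order_trans[OF mult_mono_left[OF assms]]) (simp flip: le_residual_iff)

lemma double_residual_eq:
  fixes a :: "'a::lattice_domain"
  assumes "divisorial_lattice_domain TYPE('a)"
    and x: "principal x" "x \<noteq> bot" "x \<le> a"
  shows "residual x (residual x a) = a"
proof -
  have "a \<noteq> bot" using x by (auto simp: bot_unique)
  with assms(1) have "a = divisorial_closure a"
    by (auto simp: divisorial_lattice_domain_def divisorial_def)
  with divisorial_closure_eq[OF x] show ?thesis by simp
qed

text \<open>The law \<open>residual_Sup\<close> holds in every multiplicative lattice; its dual does not.  Here it comes from
  applying \<open>residual_Sup\<close> to the join of the \<open>(x : d)\<close> and undoing residuals twice.  The family must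
  be nonempty for this join to lie above \<open>x\<close>.\<close>

lemma residual_Inf:
  fixes x :: "'a::lattice_domain"
  assumes div: "divisorial_lattice_domain TYPE('a)"
    and x: "principal x" "x \<noteq> bot"
    and D: "\<And>d. d \<in> D \<Longrightarrow> x \<le> d" "D \<noteq> {}"
  shows "residual x (Inf D) = (SUP d\<in>D. residual x d)"
proof -
  obtain d where "d \<in> D" using D(2) by blast
  then have "x \<le> (SUP d\<in>D. residual x d)"
    by (rule SUP_upper2) (simp add: le_residual_iff mult_le_left)
  then have "(SUP d\<in>D. residual x d) = residual x (residual x (SUP d\<in>D. residual x d))"
    using double_residual_eq[OF div x] by simp
  also have "residual x (SUP d\<in>D. residual x d) = (INF d\<in>D. residual x (residual x d))"
    by (simp add: residual_Sup image_image)
  also have "\<dots> = Inf D"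
    using double_residual_eq[OF div x D(1)] by simp
  finally show ?thesis by simp
qed

text \<open>The witness is the product of all \<open>d \<in> F\<close>: each factor \<open>d\<close> takes \<open>(x : d)\<close> below \<open>x\<close>, and
  the product is not below \<open>n\<close> because \<open>n\<close> is prime.\<close>

lemma annihilator_of_finite_Sup:
  fixes n x :: "'a::multiplicative_lattice"
  assumes n: "prime_element n"
    and "finite F" "\<And>d. d \<in> F \<Longrightarrow> \<not> d \<le> n"
  shows "\<exists>q. \<not> q \<le> n \<and> q * (SUP d\<in>F. residual x d) \<le> x"
  using assms(2,3)
proof (induction F)
  case empty
  have "\<not> 1 \<le> n"
    using n by (auto simp: prime_element_def one_eq_top top_unique)
  moreover have "1 * Sup {} \<le> x" by simp
  ultimately show ?case by auto
next
  case (insert d F)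
  then obtain q where q: "\<not> q \<le> n" "q * (SUP d\<in>F. residual x d) \<le> x" by auto
  have "\<not> d * q \<le> n"
    using n q(1) insert.prems unfolding prime_element_def by blast
  moreover have "(d * q) * residual x d \<le> x"
  proof -
    have "(d * q) * residual x d \<le> d * residual x d"
      by (intro mult_mono mult_le_left order_refl)
    also have "\<dots> \<le> x" by (simp add: mult.commute[of d] flip: le_residual_iff)
    finally show ?thesis .
  qed
  moreover have "(d * q) * (SUP d\<in>F. residual x d) \<le> x"
    by (rule order_trans[OF mult_mono[OF mult_le_right order_refl] q(2)])
  ultimately show ?case by (auto simp: mult_sup)
qed

text \<open>By duality, \<open>Inf D \<le> n\<close> would put \<open>(x : n)\<close> below the join of the \<open>(x : d)\<close>.  A compact
  \<open>k \<le> (x : n)\<close> is then below finitely many of them, so \<open>k\<close> is annihilated modulo \<open>x\<close> by an element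
  that is not below \<open>n\<close>.  It is also annihilated by \<open>n\<close>, hence by \<open>1\<close>.  But \<open>(x : n)\<close> is not below
  \<open>x\<close>, since \<open>n\<close> is proper, so \<open>k\<close> can be chosen not below \<open>x\<close>.\<close>

lemma Inf_not_le_maximal:
  fixes n x :: "'a::lattice_domain"
  assumes div: "divisorial_lattice_domain TYPE('a)"
    and x: "principal x" "x \<noteq> bot"
    and n: "maximal_element n" "x \<le> n"
    and D: "\<And>d. d \<in> D \<Longrightarrow> x \<le> d" "\<And>d. d \<in> D \<Longrightarrow> \<not> d \<le> n"
  shows "\<not> Inf D \<le> n"
proof
  assume le: "Inf D \<le> n"
  have "n \<noteq> 1" using n(1) by (simp add: maximal_element_def)
  with le have "D \<noteq> {}" by (auto simp: one_eq_top top_unique)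
  have "\<not> residual x n \<le> x"
  proof
    assume "residual x n \<le> x"
    then have "1 \<le> residual x (residual x n)" by (simp add: le_residual_iff)
    then show False
      using double_residual_eq[OF div x n(2)] \<open>n \<noteq> 1\<close> by (simp add: one_eq_top top_unique)
  qed
  moreover obtain S where S: "\<forall>s\<in>S. compact_element s" "residual x n = Sup S"
    using compactly_generated by blast
  ultimately obtain k where k: "compact_element k" "k \<le> residual x n" "\<not> k \<le> x"
    by (metis Sup_least Sup_upper)
  have "k \<le> (SUP d\<in>D. residual x d)"
    using k(2) residual_antimono[OF le] residual_Inf[OF div x D(1) \<open>D \<noteq> {}\<close>]
    by (metis order_trans)
  then obtain T where "T \<subseteq> residual x ` D" "finite T" "k \<le> Sup T"
    using k(1) unfolding compact_element_def by blast
  then obtain F where F: "F \<subseteq> D" "finite F" "k \<le> (SUP d\<in>F. residual x d)"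
    by (metis finite_subset_image)
  then obtain q where q: "\<not> q \<le> n" "q * (SUP d\<in>F. residual x d) \<le> x"
    using annihilator_of_finite_Sup[OF maximal_element_prime[OF n(1)] F(2)] D(2) by blast
  have "k * q \<le> x"
    using q(2) mult_mono_left[OF F(3), of q] by (metis mult.commute order_trans)
  moreover have "k * n \<le> x" using k(2) by (simp add: le_residual_iff)
  ultimately have "k * sup n q \<le> x" by (simp add: mult_sup)
  then show False using k(3) maximal_sup_eq_one[OF n(1) q(1)] by simp
qed

section \<open>h-locality\<close>

lemma finite_maximal_above:
  fixes b :: "'a::lattice_domain"
  assumes div: "divisorial_lattice_domain TYPE('a)" and "b \<noteq> bot"
  shows "finite {m. maximal_element m \<and> b \<le> m}"
proof (cases "{m. maximal_element m \<and> b \<le> m} = {}")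
  case True
  then show ?thesis by (metis finite.emptyI)
next
  case False
  define A where "A = {m. maximal_element m \<and> b \<le> m}"
  obtain x where x: "principal x" "x \<noteq> bot" "x \<le> b"
    using ex_principal_below[OF \<open>b \<noteq> bot\<close>] by blast
  define co where "co n = Inf (A - {n})" for n
  have co: "\<not> co n \<le> n" if "n \<in> A" for n
    unfolding co_def
  proof (rule Inf_not_le_maximal[OF div x(1,2)])
    show "maximal_element n" "x \<le> n" using that x(3) by (auto simp: A_def)
    fix d assume "d \<in> A - {n}"
    then show "x \<le> d" "\<not> d \<le> n"
      using that x(3) by (auto simp: A_def maximal_element_def)
  qed
  have "(SUP n\<in>A. co n) = 1"
  proof (rule ccontr)
    assume "(SUP n\<in>A. co n) \<noteq> 1"
    then obtain m where m: "maximal_element m" "(SUP n\<in>A. co n) \<le> m"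
      using ex_maximal_above by blast
    \<comment> \<open>Nonemptiness of \<open>A\<close> puts the join, and hence \<open>m\<close>, above \<open>b\<close>.\<close>
    obtain a where "a \<in> A" using False by (auto simp: A_def)
    have "b \<le> co a" by (auto simp: co_def A_def intro: Inf_greatest)
    with m(2) \<open>a \<in> A\<close> have "b \<le> m" by (meson SUP_le_iff order_trans)
    with m have "m \<in> A" by (simp add: A_def)
    with m(2) co show False by (meson SUP_le_iff)
  qed
  then obtain T where "T \<subseteq> co ` A" "finite T" "1 \<le> Sup T"
    using compact_one unfolding compact_element_def by (metis order_refl)
  then obtain F where F: "F \<subseteq> A" "finite F" "1 \<le> (SUP n\<in>F. co n)"
    by (metis finite_subset_image)
  have "A \<subseteq> F"
  proof
    fix m assume m: "m \<in> A"
    show "m \<in> F"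
    proof (rule ccontr)
      assume "m \<notin> F"
      then have "(SUP n\<in>F. co n) \<le> m"
        using m by (auto simp: co_def intro!: SUP_least Inf_lower)
      with F(3) have "m = 1" by (metis one_eq_top top_unique order_trans)
      with m show False by (simp add: A_def maximal_element_def)
    qed
  qed
  then show ?thesis unfolding A_def using F(2) by (rule finite_subset)
qed

text \<open>Primeness gives \<open>(p : y) \<le> p\<close>, so dividing the hypothesis by \<open>y\<close>, which is what principality
  of \<open>y\<close> permits, leaves \<open>1 \<le> y \<or> p\<close>.\<close>

lemma prime_cancel_principal:
  fixes p y :: "'a::multiplicative_lattice"
  assumes p: "prime_element p" and y: "principal y" "\<not> y \<le> p" and le: "y \<le> sup (y * y) p"
  shows "sup y p = 1"
proof -
  have "residual p y * y \<le> p" by (simp flip: le_residual_iff)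
  with p y(2) have "residual p y \<le> p" unfolding prime_element_def by blast
  have "1 \<le> residual (sup (y * y) p) y" using le by (simp add: le_residual_iff)
  also have "\<dots> = sup y (residual p y)" using y(1) by (simp add: principal_def)
  also have "\<dots> \<le> sup y p" using \<open>residual p y \<le> p\<close> by (rule sup_mono[OF order_refl])
  finally show ?thesis by (simp add: one_eq_top top_unique)
qed

lemma le_maximal_above_prime:
  fixes p n :: "'a::lattice_domain"
  assumes div: "divisorial_lattice_domain TYPE('a)"
    and p: "prime_element p" "p \<noteq> bot"
    and n: "maximal_element n" "p \<le> n"
    and a: "p \<le> a" "a \<noteq> 1"
  shows "a \<le> n"
proof (rule ccontr)
  assume "\<not> a \<le> n"
  obtain x where x: "principal x" "x \<noteq> bot" "x \<le> p"
    using ex_principal_below[OF p(2)] by blast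
  define c where "c = Inf {d. p \<le> d \<and> \<not> d \<le> n}"
  have least: "c \<le> d" if "p \<le> d" "\<not> d \<le> n" for d
    using that by (auto simp: c_def intro: Inf_lower)
  have "\<not> c \<le> n"
    unfolding c_def
    by (rule Inf_not_le_maximal[OF div x(1,2) n(1)]) (use x(3) n(2) in \<open>auto intro: order_trans\<close>)
  moreover obtain S where "\<forall>s\<in>S. principal s" "c = Sup S"
    using principally_generated by blast
  ultimately obtain y where y: "principal y" "y \<le> c" "\<not> y \<le> n"
    by (metis Sup_least Sup_upper)
  have "\<not> y * y \<le> n"
    using maximal_element_prime[OF n(1)] y(3) unfolding prime_element_def by blast
  then have "c \<le> sup (y * y) p" by (intro least) auto
  with y(2) have "y \<le> sup (y * y) p" by (rule order_trans)
  moreover have "\<not> y \<le> p" using y(3) n(2) by (meson order_trans)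
  ultimately have "sup y p = 1" using prime_cancel_principal p(1) y(1) by blast
  moreover have "sup y p \<le> a"
    using y(2) least[OF a(1) \<open>\<not> a \<le> n\<close>] a(1) by (meson le_supI order_trans)
  ultimately show False using a(2) by (simp add: one_eq_top top_unique)
qed

theorem theorem14:
  assumes "divisorial_lattice_domain TYPE('a::lattice_domain)"
  shows "h_local TYPE('a)"
  unfolding h_local_def
proof (intro conjI allI impI)
  fix p :: 'a assume p: "prime_element p \<and> p \<noteq> bot"
  then obtain m where m: "maximal_element m" "p \<le> m"
    using ex_maximal_above[of p] by (auto simp: prime_element_def)
  show "\<exists>!m. maximal_element m \<and> p \<le> m"
  proof (rule ex1I[of _ m])
    show "maximal_element m \<and> p \<le> m" using m by simp
    fix n assume n: "maximal_element n \<and> p \<le> n"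
    then have "n \<noteq> 1" by (simp add: maximal_element_def)
    with n m p have "n \<le> m" using le_maximal_above_prime[OF assms] by blast
    with m n show "n = m" unfolding maximal_element_def by blast
  qed
next
  fix b :: 'a assume "b \<noteq> bot"
  then show "finite {m. maximal_element m \<and> b \<le> m}"
    by (rule finite_maximal_above[OF assms])
qed

end
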